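(* Let $L\ge 2$ be an integer, $\lambda>0$, $T_{\rm D}>0$, $\tilde T_{\rm P}>0$, and $P_{\rm MD},P_{\rm FA}\in[0,1]$. Suppose that the number $K$ of active users per session of CRA-2 has the steady-state distribution $$\Pr(K=k)=\frac{\beta_2^k}{k!}e^{-\beta_2},\quad k=0,1,2,\dots,\qquad \beta_2=\lambda\bar Y,$$ where $\bar Y=\tilde T_{\rm P}+T_{\rm D}\bar D$ is the (existing, finite) mean session length and $\bar D=\mathbb E\big[\mathbb E[D\mid K]\big]$. Let $\bar D_1=\mathbb E\big[\mathbb E[D_1\mid K]\big]$ be the average number of successfully transmitted packets in a session. Then $$\bar D_1=(1-P_{\rm MD})\,\beta_2\,e^{-\beta_2/L},$$ and the throughput $\eta_2=\bar D_1/\bar Y$ of CRA-2 is $$\eta_2=\lambda\,(1-P_{\rm MD})\,e^{-\beta_2/L}.$$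
   Context: The scheme (CRA-2) works in sessions. Each active user picks one of $L$ preambles at random; $D=D_1+D_2+D_3$ is the number of preambles declared detected by the base station ($D_1$: correctly detected preambles chosen by exactly one user; $D_2$: correctly detected preambles chosen by at least two users; $D_3$: falsely detected preambles). The second stage of the session has $D$ packet slots, one per detected preamble; a packet is successful iff it is alone in its slot, so $D_1$ packets succeed, and unsuccessful packets are dropped. $P_{\rm MD}$ and $P_{\rm FA}$ are the constant missed-detection probability per transmitted preamble and false-alarm probability per untransmitted preamble. The conditional means given $K=k$ are $$\mathbb E[D_1\mid K=k]=(1-P_{\rm MD})L\alpha_1,\quad \mathbb E[D_2\mid K=k]=(1-P_{\rm MD})L(1-\alpha_1-\alpha_2),\quad \mathbb E[D_3\mid K=k]=P_{\rm FA}L\alpha_2,$$ with $\alpha_1=\frac{k}{L}(1-\frac1L)^{k-1}$ and $\alpha_2=(1-\frac1L)^{k}$. A session with $D$ detected preambles has length $\tilde T_{\rm P}+T_{\rm D}D$, where $\tilde T_{\rm P}$ is the preamble duration plus total feedback duration and $T_{\rm D}$ is the packet duration; $\lambda$ is the traffic intensity (users per unit time). *)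

theory Defs
  imports "HOL-Probability.Probability"
begin

text \<open>
  A session of CRA-2 is described by two random variables on a probability space:
  \<^item> \<open>pick\<close>, the list of the preambles chosen by the active users (preambles are \<open>0, \<dots>, L - 1\<close>,
    and \<open>pick \<omega> ! i\<close> is the choice of user \<open>i\<close>), so that the number of active users is its length;
  \<^item> \<open>detd\<close>, the set of the preambles declared detected by the base station.
\<close>

definition num_active :: "('w \<Rightarrow> nat list) \<Rightarrow> 'w \<Rightarrow> nat"  \<comment> \<open>\<open>K\<close>\<close>
  where "num_active pick \<omega> = length (pick \<omega>)"

definition num_choosing :: "('w \<Rightarrow> nat list) \<Rightarrow> nat \<Rightarrow> 'w \<Rightarrow> nat"
  where "num_choosing pick l \<omega> = count_list (pick \<omega>) l"

definition num_det_single :: "nat \<Rightarrow> ('w \<Rightarrow> nat list) \<Rightarrow> ('w \<Rightarrow> nat set) \<Rightarrow> 'w \<Rightarrow> nat"  \<comment> \<open>\<open>D\<^sub>1\<close>\<close>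
  where "num_det_single L pick detd \<omega> = card {l \<in> {..<L}. l \<in> detd \<omega> \<and> num_choosing pick l \<omega> = 1}"

definition num_det_collided :: "nat \<Rightarrow> ('w \<Rightarrow> nat list) \<Rightarrow> ('w \<Rightarrow> nat set) \<Rightarrow> 'w \<Rightarrow> nat"  \<comment> \<open>\<open>D\<^sub>2\<close>\<close>
  where "num_det_collided L pick detd \<omega> = card {l \<in> {..<L}. l \<in> detd \<omega> \<and> num_choosing pick l \<omega> \<ge> 2}"

definition num_det_false :: "nat \<Rightarrow> ('w \<Rightarrow> nat list) \<Rightarrow> ('w \<Rightarrow> nat set) \<Rightarrow> 'w \<Rightarrow> nat"  \<comment> \<open>\<open>D\<^sub>3\<close>\<close>
  where "num_det_false L pick detd \<omega> = card {l \<in> {..<L}. l \<in> detd \<omega> \<and> num_choosing pick l \<omega> = 0}"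

definition num_detected :: "nat \<Rightarrow> ('w \<Rightarrow> nat list) \<Rightarrow> ('w \<Rightarrow> nat set) \<Rightarrow> 'w \<Rightarrow> nat"  \<comment> \<open>\<open>D\<close>\<close>
  where "num_detected L pick detd \<omega> =
    num_det_single L pick detd \<omega> + num_det_collided L pick detd \<omega> + num_det_false L pick detd \<omega>"

text \<open>
  The conditional probabilities are only constrained where the conditioning event has positive
  probability. Detection of a preamble is conditioned on the number of active users and on the
  number of users that chose this preamble, so that the missed-detection and false-alarm
  probabilities do not depend on the load; no independence between different preambles is assumed.
\<close>

locale cra2_session = prob_space M
  for M :: "'w measure" +
  fixes L :: nat and P_MD P_FA :: real
    and pick :: "'w \<Rightarrow> nat list" and detd :: "'w \<Rightarrow> nat set"
  assumes pick_measurable: "pick \<in> measurable M (count_space UNIV)"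
    and pick_range: "\<And>\<omega>. \<omega> \<in> space M \<Longrightarrow> set (pick \<omega>) \<subseteq> {..<L}"
    and pick_uniform: "\<And>c. set c \<subseteq> {..<L} \<Longrightarrow>
      \<P>(\<omega> in M. num_active pick \<omega> = length c) > 0 \<Longrightarrow>
      \<P>(\<omega> in M. pick \<omega> = c \<bar> num_active pick \<omega> = length c) = 1 / real L ^ length c"
    and det_measurable: "\<And>l. {\<omega> \<in> space M. l \<in> detd \<omega>} \<in> sets M"
    and det_range: "\<And>\<omega>. \<omega> \<in> space M \<Longrightarrow> detd \<omega> \<subseteq> {..<L}"
    and missed_detection: "\<And>l k m. l < L \<Longrightarrow> m \<ge> 1 \<Longrightarrow>
      \<P>(\<omega> in M. num_active pick \<omega> = k \<and> num_choosing pick l \<omega> = m) > 0 \<Longrightarrow>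
      \<P>(\<omega> in M. l \<notin> detd \<omega> \<bar> num_active pick \<omega> = k \<and> num_choosing pick l \<omega> = m) = P_MD"
    and false_alarm: "\<And>l k. l < L \<Longrightarrow>
      \<P>(\<omega> in M. num_active pick \<omega> = k \<and> num_choosing pick l \<omega> = 0) > 0 \<Longrightarrow>
      \<P>(\<omega> in M. l \<in> detd \<omega> \<bar> num_active pick \<omega> = k \<and> num_choosing pick l \<omega> = 0) = P_FA"

text \<open>\<open>\<E>[\<E>[X | K]]\<close>, with the conditional expectation taken with respect to the \<open>\<sigma>\<close>-algebra
  generated by \<open>K\<close>.\<close>

definition mean_of_cond_mean :: "'w measure \<Rightarrow> ('w \<Rightarrow> nat) \<Rightarrow> ('w \<Rightarrow> nat) \<Rightarrow> real"
  where "mean_of_cond_mean M K X =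
    (\<integral>\<omega>. real_cond_exp M (vimage_algebra (space M) K (count_space UNIV)) (\<lambda>\<omega>. real (X \<omega>)) \<omega> \<partial>M)"

definition mean_detected :: "'w measure \<Rightarrow> nat \<Rightarrow> ('w \<Rightarrow> nat list) \<Rightarrow> ('w \<Rightarrow> nat set) \<Rightarrow> real"
  where "mean_detected M L pick detd = mean_of_cond_mean M (num_active pick) (num_detected L pick detd)"

definition mean_successes :: "'w measure \<Rightarrow> nat \<Rightarrow> ('w \<Rightarrow> nat list) \<Rightarrow> ('w \<Rightarrow> nat set) \<Rightarrow> real"
  where "mean_successes M L pick detd = mean_of_cond_mean M (num_active pick) (num_det_single L pick detd)"

definition mean_session_length ::
    "'w measure \<Rightarrow> nat \<Rightarrow> real \<Rightarrow> real \<Rightarrow> ('w \<Rightarrow> nat list) \<Rightarrow> ('w \<Rightarrow> nat set) \<Rightarrow> real"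
  where "mean_session_length M L T_P T_D pick detd = T_P + T_D * mean_detected M L pick detd"

definition throughput ::
    "'w measure \<Rightarrow> nat \<Rightarrow> real \<Rightarrow> real \<Rightarrow> ('w \<Rightarrow> nat list) \<Rightarrow> ('w \<Rightarrow> nat set) \<Rightarrow> real"
  where "throughput M L T_P T_D pick detd =
    mean_successes M L pick detd / mean_session_length M L T_P T_D pick detd"

lemma lists_count_0:
  assumes "l < L"
  shows "card {c. set c \<subseteq> {..<L} \<and> length c = k \<and> count_list c l = 0} = (L - 1) ^ k"
proof -
  have "{c. set c \<subseteq> {..<L} \<and> length c = k \<and> count_list c l = 0}
      = {c. set c \<subseteq> {..<L} - {l} \<and> length c = k}"
    by (auto simp: count_list_0_iff)
  then show ?thesis
    using assms by (simp add: card_lists_length_eq)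
qed

lemma lists_count_1:
  assumes "l < L"
  shows "card {c. set c \<subseteq> {..<L} \<and> length c = k \<and> count_list c l = 1} = k * (L - 1) ^ (k - 1)"
proof (induction k)
  case 0
  have "{c. set c \<subseteq> {..<L} \<and> length c = 0 \<and> count_list c l = 1} = {}" by auto
  then show ?case by simp
next
  case (Suc k)
  let ?S = "\<lambda>k m. {c. set c \<subseteq> {..<L} \<and> length c = k \<and> count_list c l = m}"
  have fin: "finite (?S k m)" for k m
    by (rule finite_subset[OF _ finite_lists_length_eq[of "{..<L}" k]]) auto
  let ?A = "(#) l ` ?S k 0" and ?B = "(\<lambda>(x, c). x # c) ` (({..<L} - {l}) \<times> ?S k 1)"
  have "?S (Suc k) 1 = ?A \<union> ?B"
  proof (intro subset_antisym subsetI)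
    fix c assume "c \<in> ?S (Suc k) 1"
    then show "c \<in> ?A \<union> ?B"
      by (cases c) (auto simp: image_iff split: if_splits)
  qed (use assms in auto)
  moreover have "?A \<inter> ?B = {}" by auto
  moreover have "card ?A = (L - 1) ^ k"
    using lists_count_0[OF assms] by (simp add: card_image)
  moreover have "card ?B = (L - 1) * (k * (L - 1) ^ (k - 1))"
    using assms Suc by (subst card_image) (auto simp: inj_on_def card_cartesian_product)
  moreover have "finite ?A" "finite ?B" by (auto intro!: finite_imageI fin)
  ultimately have "card (?S (Suc k) 1) = (L - 1) ^ k + (L - 1) * (k * (L - 1) ^ (k - 1))"
    by (simp only: card_Un_disjoint)
  also have "\<dots> = Suc k * (L - 1) ^ (Suc k - 1)"
    by (cases k) (auto simp: distrib_left distrib_right ac_simps)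
  finally show ?case .
qed

context cra2_session
begin

lemma events [measurable]:
  "pick \<in> measurable M (count_space UNIV)" "Measurable.pred M (\<lambda>\<omega>. l \<in> detd \<omega>)"
  "num_active pick \<in> measurable M (count_space UNIV)"
  "num_choosing pick l \<in> measurable M (count_space UNIV)"
proof -
  show [measurable]: "pick \<in> measurable M (count_space UNIV)" by (rule pick_measurable)
  show "Measurable.pred M (\<lambda>\<omega>. l \<in> detd \<omega>)"
    using det_measurable by (simp add: pred_def)
  show "num_active pick \<in> measurable M (count_space UNIV)"
    unfolding num_active_def[abs_def] by measurable
  show "num_choosing pick l \<in> measurable M (count_space UNIV)"
    unfolding num_choosing_def[abs_def]
    by (rule measurable_compose[OF pick_measurable]) simp
qed

lemma num_detected_eq_card:
  assumes "\<omega> \<in> space M"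
  shows "num_detected L pick detd \<omega> = card (detd \<omega>)"
proof -
  let ?S = "\<lambda>P. {l \<in> {..<L}. l \<in> detd \<omega> \<and> P (num_choosing pick l \<omega>)}"
  have "detd \<omega> = ?S (\<lambda>m. m = 1) \<union> ?S (\<lambda>m. m \<ge> 2) \<union> ?S (\<lambda>m. m = 0)"
    using det_range[OF assms] by auto
  also have "card \<dots> = num_detected L pick detd \<omega>"
    unfolding num_detected_def num_det_single_def num_det_collided_def num_det_false_def
    by (subst card_Un_disjoint; (subst card_Un_disjoint)?) auto
  finally show ?thesis by simp
qed

text \<open>\<open>D\<^sub>1\<close> is the number of successful packets: user \<open>i\<close> transmits in the slot of its preamble
  if this preamble is detected, and is alone there iff nobody else chose this preamble.\<close>

lemma num_det_single_eq_successes: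
  assumes "\<omega> \<in> space M"
  shows "num_det_single L pick detd \<omega> = card {i \<in> {..<num_active pick \<omega>}. pick \<omega> ! i \<in> detd \<omega> \<and>
    (\<forall>j<num_active pick \<omega>. j \<noteq> i \<longrightarrow> pick \<omega> ! j \<noteq> pick \<omega> ! i)}" (is "_ = card ?I")
proof -
  let ?xs = "pick \<omega>"
  have count: "count_list ?xs l = card {i. i < length ?xs \<and> l = ?xs ! i}" for l
    by (simp add: count_list_eq_length_filter length_filter_conv_card)
  have one: "count_list ?xs l = 1 \<longleftrightarrow> (\<exists>i. {j. j < length ?xs \<and> l = ?xs ! j} = {i})" for l
    unfolding count by (simp add: card_1_singleton_iff)
  have "inj_on ((!) ?xs) ?I"
  proof (rule inj_onI)
    fix i j assume "i \<in> ?I" "j \<in> ?I" "?xs ! i = ?xs ! j"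
    then show "i = j" by (cases "i = j") auto
  qed
  then have "card ?I = card ((!) ?xs ` ?I)" by (rule card_image[symmetric])
  also have "(!) ?xs ` ?I = {l \<in> {..<L}. l \<in> detd \<omega> \<and> num_choosing pick l \<omega> = 1}"
  proof (intro subset_antisym subsetI)
    fix l assume "l \<in> (!) ?xs ` ?I"
    then obtain i where i: "l = ?xs ! i" "i \<in> ?I" by blast
    then have "{j. j < length ?xs \<and> l = ?xs ! j} = {i}" by (fastforce simp: num_active_def)
    then have "num_choosing pick l \<omega> = 1" unfolding num_choosing_def one by blast
    then show "l \<in> {l \<in> {..<L}. l \<in> detd \<omega> \<and> num_choosing pick l \<omega> = 1}"
      using i det_range[OF assms] by auto
  next
    fix l assume l: "l \<in> {l \<in> {..<L}. l \<in> detd \<omega> \<and> num_choosing pick l \<omega> = 1}"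
    then obtain i where i: "{j. j < length ?xs \<and> l = ?xs ! j} = {i}"
      unfolding num_choosing_def one by blast
    have il: "i < length ?xs" "l = ?xs ! i" using i by blast+
    have "\<forall>j<length ?xs. j \<noteq> i \<longrightarrow> ?xs ! j \<noteq> ?xs ! i"
    proof (intro allI impI notI)
      fix j assume "j < length ?xs" "j \<noteq> i" "?xs ! j = ?xs ! i"
      then have "j \<in> {j. j < length ?xs \<and> l = ?xs ! j}" using il by simp
      then show False using i \<open>j \<noteq> i\<close> by simp
    qed
    with il l have "i \<in> ?I" by (simp add: num_active_def)
    then show "l \<in> (!) ?xs ` ?I" using il(2) by (rule rev_image_eqI)
  qed
  finally show ?thesis by (simp add: num_det_single_def)
qed

lemma subalgebra_num_active:
  "sigma_finite_subalgebra M (vimage_algebra (space M) (num_active pick) (count_space UNIV))"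
proof -
  have "subalgebra M (vimage_algebra (space M) (num_active pick) (count_space UNIV))"
    unfolding subalgebra_def by (auto simp: sets_vimage_algebra2 intro!: measurable_sets events)
  then interpret finite_measure_subalgebra M
      "vimage_algebra (space M) (num_active pick) (count_space UNIV)"
    by unfold_locales
  show ?thesis by unfold_locales
qed

lemma num_detected_integrable: "integrable M (\<lambda>\<omega>. real (num_detected L pick detd \<omega>))"
proof (rule integrable_const_bound[where B = "real L"])
  show "AE \<omega> in M. norm (real (num_detected L pick detd \<omega>)) \<le> real L"
    using num_detected_eq_card card_mono[OF finite_lessThan det_range] by auto
  show "(\<lambda>\<omega>. real (num_detected L pick detd \<omega>)) \<in> borel_measurable M"
    unfolding num_detected_def num_det_single_def num_det_collided_def num_det_false_def
    by measurable
qed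

lemma mean_session_length_eq:
  "mean_session_length M L T_P T_D pick detd =
    (\<integral>\<omega>. T_P + T_D * real (num_detected L pick detd \<omega>) \<partial>M)"
proof -
  interpret sigma_finite_subalgebra M
      "vimage_algebra (space M) (num_active pick) (count_space UNIV)"
    by (rule subalgebra_num_active)
  show ?thesis
    unfolding mean_session_length_def mean_detected_def mean_of_cond_mean_def
    using real_cond_exp_int(2)[OF num_detected_integrable] num_detected_integrable
    by (simp add: prob_space)
qed

context
  fixes k :: nat
  assumes pos: "\<P>(\<omega> in M. num_active pick \<omega> = k) > 0"
begin

abbreviation "M_k \<equiv> uniform_measure M {\<omega> \<in> space M. num_active pick \<omega> = k}"

lemma prob_space_M_k: "prob_space M_k"
  by (rule prob_space_uniform_measure) (use pos in \<open>auto simp: emeasure_eq_measure\<close>)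

lemma M_k_eq:
  assumes [measurable]: "Measurable.pred M P"
  shows "\<P>(\<omega> in M_k. P \<omega>) = \<P>(\<omega> in M. P \<omega> \<and> num_active pick \<omega> = k) / \<P>(\<omega> in M. num_active pick \<omega> = k)"
proof -
  have "\<P>(\<omega> in M_k. P \<omega>) = \<P>(\<omega> in M. P \<omega> \<bar> num_active pick \<omega> = k)"
    using measure_uniform_measure_eq_cond_prob[of P "\<lambda>\<omega>. num_active pick \<omega> = k"] by simp
  then show ?thesis by (simp add: cond_prob_def)
qed

lemma count_prob:
  assumes "l < L"
  shows "\<P>(\<omega> in M_k. num_choosing pick l \<omega> = m) =
    real (card {c. set c \<subseteq> {..<L} \<and> length c = k \<and> count_list c l = m}) / real L ^ k"
proof -
  let ?S = "{c. set c \<subseteq> {..<L} \<and> length c = k \<and> count_list c l = m}"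
  have fin: "finite ?S"
    by (rule finite_subset[OF _ finite_lists_length_eq[of "{..<L}" k]]) auto
  have "{\<omega> \<in> space M. num_choosing pick l \<omega> = m \<and> num_active pick \<omega> = k}
     = (\<Union>c\<in>?S. {\<omega> \<in> space M. pick \<omega> = c})"
    using pick_range by (auto simp: num_choosing_def num_active_def)
  then have "\<P>(\<omega> in M. num_choosing pick l \<omega> = m \<and> num_active pick \<omega> = k)
     = prob (\<Union>c\<in>?S. {\<omega> \<in> space M. pick \<omega> = c})" by simp
  also have "\<dots> = (\<Sum>c\<in>?S. \<P>(\<omega> in M. pick \<omega> = c))"
    by (rule finite_measure_finite_Union[OF fin]) (auto simp: disjoint_family_on_def)
  also have "\<dots> = (\<Sum>c\<in>?S. \<P>(\<omega> in M. num_active pick \<omega> = k) / real L ^ k)"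
  proof (rule sum.cong)
    fix c assume c: "c \<in> ?S"
    have "{\<omega> \<in> space M. pick \<omega> = c \<and> num_active pick \<omega> = k} = {\<omega> \<in> space M. pick \<omega> = c}"
      using c by (auto simp: num_active_def)
    then show "\<P>(\<omega> in M. pick \<omega> = c) = \<P>(\<omega> in M. num_active pick \<omega> = k) / real L ^ k"
      using pick_uniform[of c] c pos by (simp add: cond_prob_def field_simps)
  qed simp
  finally show ?thesis
    using pos by (subst M_k_eq) simp_all
qed

lemma count_prob_0:
  assumes "l < L"
  shows "\<P>(\<omega> in M_k. num_choosing pick l \<omega> = 0) = (1 - 1 / real L) ^ k"
proof -
  have "(1 - 1 / real L) = (real L - 1) / real L" using assms by (simp add: field_simps)
  then show ?thesis
    using assms unfolding count_prob[OF assms] lists_count_0[OF assms] by (simp add: power_divide)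
qed

lemma count_prob_1:
  assumes "l < L"
  shows "\<P>(\<omega> in M_k. num_choosing pick l \<omega> = 1) = real k / real L * (1 - 1 / real L) ^ (k - 1)"
proof -
  have eq: "(1 - 1 / real L) = (real L - 1) / real L" using assms by (simp add: field_simps)
  show ?thesis
    using assms unfolding count_prob[OF assms] lists_count_1[OF assms] eq
    by (cases k) (auto simp: power_divide distrib_left distrib_right add_divide_distrib)
qed

lemma det_prob:
  assumes "l < L"
  shows "\<P>(\<omega> in M_k. l \<in> detd \<omega> \<and> num_choosing pick l \<omega> = m) =
    (if m = 0 then P_FA else 1 - P_MD) * \<P>(\<omega> in M_k. num_choosing pick l \<omega> = m)"
proof -
  let ?Q = "\<lambda>\<omega>. num_active pick \<omega> = k \<and> num_choosing pick l \<omega> = m"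
  let ?q = "\<P>(\<omega> in M. ?Q \<omega>)"
  let ?a = "\<P>(\<omega> in M. l \<in> detd \<omega> \<and> ?Q \<omega>)" and ?b = "\<P>(\<omega> in M. l \<notin> detd \<omega> \<and> ?Q \<omega>)"
  have "?q = prob ({\<omega> \<in> space M. l \<in> detd \<omega> \<and> ?Q \<omega>} \<union> {\<omega> \<in> space M. l \<notin> detd \<omega> \<and> ?Q \<omega>})"
    by (rule arg_cong[where f = prob]) auto
  also have "\<dots> = ?a + ?b"
    by (rule finite_measure_Union) auto
  finally have sum: "?q = ?a + ?b" .
  have nonneg: "?a \<ge> 0" "?b \<ge> 0" by auto
  have "?a = (if m = 0 then P_FA else 1 - P_MD) * ?q"
  proof (cases "?q = 0")
    case True
    then have "?a = 0" using sum nonneg by linarith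
    with True show ?thesis by simp
  next
    case False
    then have q: "?q > 0" by (simp add: zero_less_measure_iff)
    show ?thesis
    proof (cases "m = 0")
      case True
      then show ?thesis using false_alarm[of l k] assms q by (simp add: cond_prob_def field_simps)
    next
      case False
      then have "?b = P_MD * ?q"
        using missed_detection[of l m k] assms q by (simp add: cond_prob_def field_simps)
      then show ?thesis using sum False by (simp add: algebra_simps)
    qed
  qed
  then show ?thesis
    by (subst (1 2) M_k_eq) (simp_all add: conj_commute conj_left_commute)
qed

lemma integral_card:
  assumes [measurable]: "\<And>l. Measurable.pred M (P l)"
  shows "(\<integral>\<omega>. real (card {l \<in> {..<L}. P l \<omega>}) \<partial>M_k) = (\<Sum>l<L. \<P>(\<omega> in M_k. P l \<omega>))"
proof -
  interpret Mk: prob_space M_k by (rule prob_space_M_k)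
  have "(\<integral>\<omega>. real (card {l \<in> {..<L}. P l \<omega>}) \<partial>M_k)
      = (\<integral>\<omega>. (\<Sum>l<L. indicator {\<omega> \<in> space M_k. P l \<omega>} \<omega>) \<partial>M_k)"
  proof (rule Bochner_Integration.integral_cong)
    fix \<omega> assume "\<omega> \<in> space M_k"
    then have "(\<Sum>l<L. indicator {\<omega> \<in> space M_k. P l \<omega>} \<omega>) = (\<Sum>l<L. if P l \<omega> then 1 else (0::real))"
      by (intro sum.cong) (auto simp: indicator_def)
    also have "\<dots> = real (card {l \<in> {..<L}. P l \<omega>})"
      by (subst sum.inter_filter[symmetric]) auto
    finally show "real (card {l \<in> {..<L}. P l \<omega>}) = (\<Sum>l<L. indicator {\<omega> \<in> space M_k. P l \<omega>} \<omega>)" by simp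
  qed simp
  also have "\<dots> = (\<Sum>l<L. \<P>(\<omega> in M_k. P l \<omega>))"
    by (subst Bochner_Integration.integral_sum) (auto simp: Mk.emeasure_eq_measure)
  finally show ?thesis .
qed

text \<open>The conditional means given \<open>K = k\<close>.\<close>

lemma cond_mean_D1:
  "(\<integral>\<omega>. real (num_det_single L pick detd \<omega>) \<partial>M_k) =
    (1 - P_MD) * real L * (real k / real L * (1 - 1 / real L) ^ (k - 1))"
proof -
  have "(\<integral>\<omega>. real (num_det_single L pick detd \<omega>) \<partial>M_k) =
      (\<Sum>l<L. \<P>(\<omega> in M_k. l \<in> detd \<omega> \<and> num_choosing pick l \<omega> = 1))"
    unfolding num_det_single_def by (rule integral_card) measurable
  also have "\<dots> = (\<Sum>l<L. (1 - P_MD) * (real k / real L * (1 - 1 / real L) ^ (k - 1)))"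
    by (intro sum.cong refl) (simp only: det_prob lessThan_iff count_prob_1 one_neq_zero if_False)
  finally show ?thesis by simp
qed

lemma cond_mean_D3:
  "(\<integral>\<omega>. real (num_det_false L pick detd \<omega>) \<partial>M_k) = P_FA * real L * (1 - 1 / real L) ^ k"
proof -
  have "(\<integral>\<omega>. real (num_det_false L pick detd \<omega>) \<partial>M_k) =
      (\<Sum>l<L. \<P>(\<omega> in M_k. l \<in> detd \<omega> \<and> num_choosing pick l \<omega> = 0))"
    unfolding num_det_false_def by (rule integral_card) measurable
  also have "\<dots> = (\<Sum>l<L. P_FA * (1 - 1 / real L) ^ k)"
    by (intro sum.cong refl) (simp only: det_prob lessThan_iff count_prob_0 simp_thms if_True)
  finally show ?thesis by simp
qed

lemma cond_mean_D2:
  "(\<integral>\<omega>. real (num_det_collided L pick detd \<omega>) \<partial>M_k) =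
    (1 - P_MD) * real L *
      (1 - real k / real L * (1 - 1 / real L) ^ (k - 1) - (1 - 1 / real L) ^ k)"
proof -
  interpret Mk: prob_space M_k by (rule prob_space_M_k)
  have AE: "AE \<omega> in M_k. num_active pick \<omega> = k"
    by (rule AE_uniform_measureI) auto
  have det: "\<P>(\<omega> in M_k. l \<in> detd \<omega> \<and> num_choosing pick l \<omega> \<ge> 2) =
    (1 - P_MD) * (1 - real k / real L * (1 - 1 / real L) ^ (k - 1) - (1 - 1 / real L) ^ k)"
    if l: "l < L" for l
  proof -
    let ?n = "num_choosing pick l" and ?I = "{2..k+1}"
    have le: "AE \<omega> in M_k. ?n \<omega> \<le> k"
      using AE by eventually_elim (auto simp: num_active_def num_choosing_def count_le_length)
    have 1: "\<P>(\<omega> in M_k. l \<in> detd \<omega> \<and> ?n \<omega> \<ge> 2) = (\<Sum>m\<in>?I. \<P>(\<omega> in M_k. l \<in> detd \<omega> \<and> ?n \<omega> = m))"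
      by (rule Mk.prob_sum) (use le in \<open>auto elim!: eventually_mono\<close>)
    have "(\<Sum>m\<in>{..k+1}. \<P>(\<omega> in M_k. ?n \<omega> = m)) = \<P>(\<omega> in M_k. True)"
      by (rule Mk.prob_sum[symmetric]) (use le in \<open>auto elim!: eventually_mono\<close>)
    also have "\<dots> = 1" using Mk.prob_space by simp
    also have "{..k+1} = insert 0 (insert 1 ?I)" by auto
    finally have 2: "(\<Sum>m\<in>?I. \<P>(\<omega> in M_k. ?n \<omega> = m)) =
        1 - \<P>(\<omega> in M_k. ?n \<omega> = 1) - \<P>(\<omega> in M_k. ?n \<omega> = 0)"
      by simp
    have "(\<Sum>m\<in>?I. \<P>(\<omega> in M_k. l \<in> detd \<omega> \<and> ?n \<omega> = m)) =
        (\<Sum>m\<in>?I. (1 - P_MD) * \<P>(\<omega> in M_k. ?n \<omega> = m))"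
      by (intro sum.cong refl, subst det_prob[OF l]) auto
    with 1 2 show ?thesis
      unfolding sum_distrib_left[symmetric] count_prob_1[OF l] count_prob_0[OF l] by simp
  qed
  have "(\<integral>\<omega>. real (num_det_collided L pick detd \<omega>) \<partial>M_k) =
      (\<Sum>l<L. \<P>(\<omega> in M_k. l \<in> detd \<omega> \<and> num_choosing pick l \<omega> \<ge> 2))"
    unfolding num_det_collided_def by (rule integral_card) measurable
  also have "\<dots> = (\<Sum>l<L. (1 - P_MD) *
      (1 - real k / real L * (1 - 1 / real L) ^ (k - 1) - (1 - 1 / real L) ^ k))"
    by (intro sum.cong refl det) auto
  finally show ?thesis by simp
qed

end

end

end

(* Given K = k, the mean of D_1 is (1 - P_MD) k q^(k-1) with q = 1 - 1/L. Averaging over the Poisson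
   law of K, the factor k cancels against k! and leaves beta_2 e^(-beta_2) times the exponential
   series of beta_2 q. The fixed-point relation beta_2 = lambda * Ybar enters only in dividing by
   Ybar, which is positive because T_P is. *)

theory Submission
  imports Defs
begin

text \<open>The uniform measure on \<open>A\<close> has density
  \<open>indicator A x / measure M A\<close> with respect to \<open>M\<close>. Clearing the
  normalisation turns a mean conditioned on \<open>A\<close> into an integral over \<open>A\<close>
  under \<open>M\<close>, and such integrals can be added over disjoint events.\<close>

lemma set_integral_uniform_measure:
  fixes f :: "'a \<Rightarrow> real"
  assumes "emeasure M A \<noteq> 0" "emeasure M A \<noteq> \<infinity>" and A: "A \<in> sets M"
    and [measurable]: "f \<in> borel_measurable M"
  shows "(LINT x:A|M. f x) = measure M A * (\<integral>x. f x \<partial>uniform_measure M A)"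
proof -
  have fin: "emeasure M A = ennreal (measure M A)"
    using assms(2) by (intro emeasure_eq_ennreal_measure) simp
  have pos: "measure M A > 0"
    using assms(1) by (simp add: fin zero_less_measure_iff)
  have "uniform_measure M A = density M (\<lambda>x. ennreal (indicator A x / measure M A))"
    unfolding uniform_measure_def fin using pos
    by (simp add: divide_ennreal[symmetric] ennreal_indicator)
  then have "(\<integral>x. f x \<partial>uniform_measure M A) = (\<integral>x. indicator A x / measure M A * f x \<partial>M)"
    using A by (simp add: integral_real_density)
  also have "\<dots> = (LINT x:A|M. f x) / measure M A"
    unfolding set_lebesgue_integral_def by simp
  finally show ?thesis
    using pos by simp
qed

lemma poisson_weighted_sums:
  fixes b q :: real
  shows "(\<lambda>k. b ^ k / fact k * exp (- b) * (real k * q ^ (k - 1))) sums (b * exp (- b * (1 - q)))"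
proof -
  \<comment> \<open>The exponential series is indexed by n = k - 1, the exponent left after k
    cancels against k!.\<close>
  have "(\<lambda>n. (b * q) ^ n /\<^sub>R fact n * (b * exp (- b))) sums (exp (b * q) * (b * exp (- b)))"
    by (intro sums_mult2 exp_converges)
  also have "exp (b * q) * (b * exp (- b)) = b * exp (- b * (1 - q))"
    by (simp add: exp_add[symmetric] algebra_simps)
  also have "(\<lambda>n. (b * q) ^ n /\<^sub>R fact n * (b * exp (- b)))
      = (\<lambda>n. b ^ Suc n / fact (Suc n) * exp (- b) * (real (Suc n) * q ^ (Suc n - 1)))"
  proof
    fix n
    have "fact (Suc n) = real (Suc n) * fact n" by simp
    then show "(b * q) ^ n /\<^sub>R fact n * (b * exp (- b))
        = b ^ Suc n / fact (Suc n) * exp (- b) * (real (Suc n) * q ^ (Suc n - 1))"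
      by (simp add: power_mult_distrib divide_simps del: of_nat_Suc fact_Suc)
  qed
  \<comment> \<open>The shift back to k adds only the term at k = 0. It vanishes through the factor
    \<open>real k\<close>, so the truncated exponent \<open>0 - 1\<close> is harmless.\<close>
  finally show ?thesis
    by (subst (asm) sums_Suc_iff) simp
qed

context cra2_session
begin

lemma num_det_single_integrable: "integrable M (\<lambda>\<omega>. real (num_det_single L pick detd \<omega>))"
proof (rule integrable_const_bound[where B = "real L"])
  show "AE \<omega> in M. norm (real (num_det_single L pick detd \<omega>)) \<le> real L"
    unfolding num_det_single_def by (intro AE_I2) (auto intro!: card_mono[of "{..<L}", simplified])
  show "(\<lambda>\<omega>. real (num_det_single L pick detd \<omega>)) \<in> borel_measurable M"
    unfolding num_det_single_def by measurable
qed

text \<open>The tower property removes the inner conditional expectation, so the averaging over K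
  can be done on a plain integral of D_1.\<close>

lemma mean_successes_eq:
  "mean_successes M L pick detd = (\<integral>\<omega>. real (num_det_single L pick detd \<omega>) \<partial>M)"
proof -
  interpret sigma_finite_subalgebra M
      "vimage_algebra (space M) (num_active pick) (count_space UNIV)"
    by (rule subalgebra_num_active)
  show ?thesis
    unfolding mean_successes_def mean_of_cond_mean_def
    by (rule real_cond_exp_int(2)[OF num_det_single_integrable])
qed

lemma mean_session_length_pos:
  assumes "T_P > 0" "T_D \<ge> 0"
  shows "mean_session_length M L T_P T_D pick detd > 0"
proof -
  have "0 \<le> (\<integral>\<omega>. real (num_detected L pick detd \<omega>) \<partial>M)" by simp
  moreover have "mean_session_length M L T_P T_D pick detd
      = T_P + T_D * (\<integral>\<omega>. real (num_detected L pick detd \<omega>) \<partial>M)"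
    unfolding mean_session_length_eq using num_detected_integrable by (simp add: prob_space)
  ultimately show ?thesis
    using assms by (simp add: add_pos_nonneg)
qed

text \<open>The product form makes sense for every k, including values of probability zero, so the
  series over k needs no case distinction.\<close>

lemma set_integral_num_det_single:
  "(LINT \<omega>:{\<omega> \<in> space M. num_active pick \<omega> = k}|M. real (num_det_single L pick detd \<omega>)) =
    \<P>(\<omega> in M. num_active pick \<omega> = k) *
      ((1 - P_MD) * real L * (real k / real L * (1 - 1 / real L) ^ (k - 1)))"
proof (cases "\<P>(\<omega> in M. num_active pick \<omega> = k) > 0")
  case True
  then show ?thesis
    using num_det_single_integrable
    by (subst set_integral_uniform_measure) (auto simp: emeasure_eq_measure cond_mean_D1)
next
  case False
  then have z: "\<P>(\<omega> in M. num_active pick \<omega> = k) = 0" by (simp add: zero_less_measure_iff)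
  then have "{\<omega> \<in> space M. num_active pick \<omega> = k} \<in> null_sets M"
    by (auto simp: null_sets_def emeasure_eq_measure)
  then have "AE \<omega> in M. \<omega> \<notin> {\<omega> \<in> space M. num_active pick \<omega> = k}"
    by (rule AE_not_in)
  then have "(LINT \<omega>:{\<omega> \<in> space M. num_active pick \<omega> = k}|M. real (num_det_single L pick detd \<omega>)) = 0"
    unfolding set_lebesgue_integral_def
    by (intro integral_eq_zero_AE) (auto elim!: eventually_mono)
  with z show ?thesis by simp
qed

text \<open>The level sets of K partition the space, and countable additivity of the integral of D_1
  over them yields the series in k.\<close>

lemma mean_successes_poisson:
  fixes b :: real
  assumes "L > 0"
    and poisson: "\<And>k. \<P>(\<omega> in M. num_active pick \<omega> = k) = b ^ k / fact k * exp (- b)"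
  shows "mean_successes M L pick detd = (1 - P_MD) * b * exp (- b / real L)"
proof -
  let ?D = "\<lambda>\<omega>. real (num_det_single L pick detd \<omega>)"
  let ?A = "\<lambda>k. {\<omega> \<in> space M. num_active pick \<omega> = k}"
  have UN: "(\<Union>k. ?A k) = space M" by auto
  have "mean_successes M L pick detd = (LINT \<omega>:(\<Union>k. ?A k)|M. ?D \<omega>)"
    unfolding UN using num_det_single_integrable by (simp add: mean_successes_eq set_integral_space)
  also have "\<dots> = (\<Sum>k. LINT \<omega>:?A k|M. ?D \<omega>)"
  proof (rule lebesgue_integral_countable_add)
    show "set_integrable M (\<Union>k. ?A k) ?D"
      unfolding UN set_integrable_def using num_det_single_integrable
      by (subst integrable_mult_indicator) auto
  qed auto
  \<comment> \<open>The number of preambles cancels the 1/L in k/L, as \<open>L > 0\<close>.\<close>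
  also have "(\<lambda>k. LINT \<omega>:?A k|M. ?D \<omega>) =
      (\<lambda>k. (1 - P_MD) * (b ^ k / fact k * exp (- b) * (real k * (1 - 1 / real L) ^ (k - 1))))"
    unfolding set_integral_num_det_single poisson using \<open>L > 0\<close> by (auto simp: field_simps)
  \<comment> \<open>With q = 1 - 1/L the exponent -b (1 - q) becomes -b/L.\<close>
  also have "(\<Sum>k. (1 - P_MD) * (b ^ k / fact k * exp (- b) * (real k * (1 - 1 / real L) ^ (k - 1))))
      = (1 - P_MD) * (b * exp (- b * (1 - (1 - 1 / real L))))"
    by (intro sums_unique[symmetric] sums_mult poisson_weighted_sums)
  finally show ?thesis by simp
qed

end

theorem mainTheorem3:
  fixes M :: "'w measure" and L :: nat
    and lam T_P T_D P_MD P_FA beta2 :: real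
    and pick :: "'w \<Rightarrow> nat list" and detd :: "'w \<Rightarrow> nat set"
  assumes "L \<ge> 2" and "lam > 0" and "T_D > 0" and "T_P > 0"
    and "P_MD \<in> {0..1}" and "P_FA \<in> {0..1}"
    and session: "cra2_session M L P_MD P_FA pick detd"
    and beta2: "beta2 = lam * mean_session_length M L T_P T_D pick detd"
    and steady_state: "\<And>k. \<P>(\<omega> in M. num_active pick \<omega> = k) = beta2 ^ k / fact k * exp (- beta2)"
  shows "mean_successes M L pick detd = (1 - P_MD) * beta2 * exp (- beta2 / real L)
    \<and> throughput M L T_P T_D pick detd = lam * (1 - P_MD) * exp (- beta2 / real L)"
proof -
  interpret cra2_session M L P_MD P_FA pick detd by (rule session)
  have D1: "mean_successes M L pick detd = (1 - P_MD) * beta2 * exp (- beta2 / real L)"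
    using mean_successes_poisson[OF _ steady_state] \<open>L \<ge> 2\<close> by simp
  have "mean_session_length M L T_P T_D pick detd \<noteq> 0"
    using mean_session_length_pos[of T_P T_D] \<open>T_P > 0\<close> \<open>T_D > 0\<close> by simp
  \<comment> \<open>Only the factor \<open>beta2\<close> is expanded into \<open>lam\<close> times
    the session length; the exponent keeps \<open>beta2\<close>, as in the claimed
    throughput.\<close>
  moreover have "mean_successes M L pick detd
      = lam * (1 - P_MD) * exp (- beta2 / real L) * mean_session_length M L T_P T_D pick detd"
    unfolding D1 by (subst (1) beta2) (simp only: ac_simps)
  ultimately have "throughput M L T_P T_D pick detd = lam * (1 - P_MD) * exp (- beta2 / real L)"
    unfolding throughput_def by (simp only: nonzero_mult_div_cancel_right not_False_eq_True)
  with D1 show ?thesis ..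
qed

end
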